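(* Let $G$ be a nontrivial CT group which contains no nontrivial abelian normal subgroup. If $G$ has a composition series, then $G$ is monolithic and its monolith $N$ is a simple nonabelian CT group.
   Context: A group $G$ is CT (commutative transitive) if for all nontrivial $x,y,z \in G$, $[x,y]=1$ and $[y,z]=1$ imply $[x,z]=1$. A group $G$ is monolithic if it contains a unique nontrivial minimal normal subgroup $N$; this subgroup $N$ is called the monolith of $G$. Composition series are understood to have finite length. *)

theory Defs
  imports "HOL-Algebra.SimpleGroups"
begin

definition commutator :: "('a, 'b) monoid_scheme \<Rightarrow> 'a \<Rightarrow> 'a \<Rightarrow> 'a" where
  "commutator G x y = inv\<^bsub>G\<^esub> x \<otimes>\<^bsub>G\<^esub> inv\<^bsub>G\<^esub> y \<otimes>\<^bsub>G\<^esub> x \<otimes>\<^bsub>G\<^esub> y"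

definition CT_group :: "('a, 'b) monoid_scheme \<Rightarrow> bool" where
  "CT_group G \<longleftrightarrow> group G \<and>
     (\<forall>x \<in> carrier G - {\<one>\<^bsub>G\<^esub>}. \<forall>y \<in> carrier G - {\<one>\<^bsub>G\<^esub>}. \<forall>z \<in> carrier G - {\<one>\<^bsub>G\<^esub>}.
        commutator G x y = \<one>\<^bsub>G\<^esub> \<and> commutator G y z = \<one>\<^bsub>G\<^esub> \<longrightarrow> commutator G x z = \<one>\<^bsub>G\<^esub>)"

text \<open>
  The library locale \<^locale>\<open>simple_group\<close> requires \<open>order G > 1\<close>, where \<open>order\<close> is the cardinality
  as a natural number and hence \<open>0\<close> for infinite groups; so it covers finite simple groups only.
  The following notion is simplicity for groups of arbitrary cardinality.
\<close>

definition simple_grp :: "('a, 'b) monoid_scheme \<Rightarrow> bool" where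
  "simple_grp G \<longleftrightarrow> group G \<and> carrier G \<noteq> {\<one>\<^bsub>G\<^esub>} \<and>
     (\<forall>H. H \<lhd> G \<longrightarrow> H = carrier G \<or> H = {\<one>\<^bsub>G\<^esub>})"

lemma simple_group_iff: "simple_group G \<longleftrightarrow> simple_grp G \<and> finite (carrier G)"
proof
  assume "simple_group G"
  then interpret simple_group G .
  show "simple_grp G \<and> finite (carrier G)"
    using is_group simple_not_triv no_real_normal_subgroup order_gt_one order_gt_0_iff_finite
    by (auto simp: simple_grp_def)
next
  assume *: "simple_grp G \<and> finite (carrier G)"
  then interpret group G by (simp add: simple_grp_def)
  have "order G \<noteq> 1" using * order_one_triv_iff by (auto simp: simple_grp_def)
  moreover have "order G > 0" using * order_gt_0_iff_finite by blast
  ultimately show "simple_group G"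
    using * by unfold_locales (auto simp: simple_grp_def)
qed

text \<open>
  \<open>H 0, \<dots>, H n\<close> is a subnormal series from the trivial subgroup to \<open>G\<close> with simple factors;
  the values of \<open>H\<close> beyond \<open>n\<close> are irrelevant.
\<close>

definition composition_series ::
    "('a, 'b) monoid_scheme \<Rightarrow> nat \<Rightarrow> (nat \<Rightarrow> 'a set) \<Rightarrow> bool" where
  "composition_series G n H \<longleftrightarrow>
     H 0 = {\<one>\<^bsub>G\<^esub>} \<and> H n = carrier G \<and> (\<forall>i\<le>n. subgroup (H i) G) \<and>
     (\<forall>i<n. H i \<lhd> G\<lparr>carrier := H (Suc i)\<rparr> \<and>
             simple_grp (G\<lparr>carrier := H (Suc i)\<rparr> Mod H i))"

definition minimal_normal_subgroup :: "'a set \<Rightarrow> ('a, 'b) monoid_scheme \<Rightarrow> bool" where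
  "minimal_normal_subgroup N G \<longleftrightarrow> N \<lhd> G \<and> N \<noteq> {\<one>\<^bsub>G\<^esub>} \<and>
     (\<forall>M. M \<lhd> G \<and> M \<noteq> {\<one>\<^bsub>G\<^esub>} \<and> M \<subseteq> N \<longrightarrow> M = N)"

definition monolithic :: "('a, 'b) monoid_scheme \<Rightarrow> bool" where
  "monolithic G \<longleftrightarrow> group G \<and> (\<exists>!N. minimal_normal_subgroup N G)"

definition monolith :: "('a, 'b) monoid_scheme \<Rightarrow> 'a set" where
  "monolith G = (THE N. minimal_normal_subgroup N G)"

end

theory Submission
  imports Defs
begin

text \<open>
  The first nontrivial term \<open>S = H 1\<close> of any composition series \<open>H\<close> is the monolith.  It is simple,
  since \<open>S\<close> is isomorphic to the first factor of the series.

  In a CT group, two nontrivial subgroups that centralise each other are both abelian: any two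
  nontrivial elements of one commute with a common nontrivial element of the other.  Since normal
  subgroups with trivial intersection centralise each other, this lets one climb the series.

  First, a nontrivial abelian normal subgroup \<open>A\<close> of \<open>H i\<close> produces one of \<open>H (i + 1)\<close>
  (lemma \<open>abelian_normal_ascends\<close>), namely the centraliser of \<open>A\<close> in \<open>H i\<close>.  As \<open>G\<close> has no such
  subgroup, \<open>S\<close> is nonabelian.

  Second, \<open>S\<close> is contained in every nontrivial normal subgroup of every \<open>H i\<close> with \<open>i > 0\<close>, and
  is itself normal in \<open>H i\<close> (lemma \<open>least_nontrivial_normal_ascends\<close>).  Indeed, the conjugates of
  \<open>S\<close> under \<open>H (i + 1)\<close> are nontrivial and normal in \<open>H i\<close>, so each contains \<open>S\<close>, and \<open>S\<close> is normal
  in \<open>H (i + 1)\<close>; and a nontrivial normal subgroup \<open>M\<close> of \<open>H (i + 1)\<close> cannot meet \<open>S\<close> trivially,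
  because \<open>S\<close> would then be abelian, so \<open>M \<inter> S\<close> is a nontrivial normal subgroup of \<open>H i\<close> and
  contains \<open>S\<close>.

  At the top of the series, \<open>S\<close> is the least nontrivial normal subgroup of \<open>G\<close>, hence the monolith.
\<close>

section \<open>Commuting elements in CT groups\<close>

lemma (in group) inv_mult_cancel_left:
  assumes "x \<in> carrier G" "y \<in> carrier G"
  shows "inv x \<otimes> (x \<otimes> y) = y" "x \<otimes> (inv x \<otimes> y) = y"
  using assms by (simp_all add: m_assoc [symmetric])

lemma (in group) conjugate_eq_one_iff:
  assumes "g \<in> carrier G" "x \<in> carrier G"
  shows "g \<otimes> x \<otimes> inv g = \<one> \<longleftrightarrow> x = \<one>"
  using assms inv_solve_right'[of \<one> "g \<otimes> x" g] by simp

lemma (in group) conjugate_mult: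
  assumes "g \<in> carrier G" "x \<in> carrier G" "y \<in> carrier G"
  shows "g \<otimes> x \<otimes> inv g \<otimes> (g \<otimes> y \<otimes> inv g) = g \<otimes> (x \<otimes> y) \<otimes> inv g"
  using assms by (simp add: m_assoc inv_mult_cancel_left)

lemma (in group) commutator_eq_one_iff:
  assumes "x \<in> carrier G" "y \<in> carrier G"
  shows "commutator G x y = \<one> \<longleftrightarrow> x \<otimes> y = y \<otimes> x"
proof -
  have "commutator G x y = inv (y \<otimes> x) \<otimes> (x \<otimes> y)"
    using assms by (simp add: commutator_def inv_mult_group m_assoc)
  then show ?thesis
    using assms inv_solve_left'[of \<one> "y \<otimes> x" "x \<otimes> y"] by simp
qed

lemma (in group) CT_group_iff:
  "CT_group G \<longleftrightarrow>
     (\<forall>x \<in> carrier G. \<forall>y \<in> carrier G - {\<one>}. \<forall>z \<in> carrier G.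
        x \<otimes> y = y \<otimes> x \<longrightarrow> y \<otimes> z = z \<otimes> y \<longrightarrow> x \<otimes> z = z \<otimes> x)"
proof
  assume CT: "CT_group G"
  show "\<forall>x \<in> carrier G. \<forall>y \<in> carrier G - {\<one>}. \<forall>z \<in> carrier G.
        x \<otimes> y = y \<otimes> x \<longrightarrow> y \<otimes> z = z \<otimes> y \<longrightarrow> x \<otimes> z = z \<otimes> x"
  proof (intro ballI impI)
    fix x y z
    assume *: "x \<in> carrier G" "y \<in> carrier G - {\<one>}" "z \<in> carrier G"
      "x \<otimes> y = y \<otimes> x" "y \<otimes> z = z \<otimes> y"
    show "x \<otimes> z = z \<otimes> x"
    proof (cases "x = \<one> \<or> z = \<one>")
      case True
      then show ?thesis using * by auto
    next
      case False
      then have "commutator G x z = \<one>"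
        using CT * commutator_eq_one_iff[of x y] commutator_eq_one_iff[of y z]
        unfolding CT_group_def by blast
      then show ?thesis using * by (simp add: commutator_eq_one_iff)
    qed
  qed
next
  assume trans: "\<forall>x \<in> carrier G. \<forall>y \<in> carrier G - {\<one>}. \<forall>z \<in> carrier G.
        x \<otimes> y = y \<otimes> x \<longrightarrow> y \<otimes> z = z \<otimes> y \<longrightarrow> x \<otimes> z = z \<otimes> x"
  show "CT_group G"
    unfolding CT_group_def
  proof (intro conjI ballI impI is_group)
    fix x y z
    assume *: "x \<in> carrier G - {\<one>}" "y \<in> carrier G - {\<one>}" "z \<in> carrier G - {\<one>}"
      "commutator G x y = \<one> \<and> commutator G y z = \<one>"
    then show "commutator G x z = \<one>"
      using trans commutator_eq_one_iff[of x y] commutator_eq_one_iff[of y z]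
        commutator_eq_one_iff[of x z] by blast
  qed
qed

lemma (in group) CT_group_subgroup:
  assumes "CT_group G" "subgroup K G"
  shows "CT_group (G\<lparr>carrier := K\<rparr>)"
proof -
  interpret K: group "G\<lparr>carrier := K\<rparr>" using assms(2) by (rule subgroup_imp_group)
  show ?thesis
    using assms subgroup.subset[OF assms(2)] unfolding K.CT_group_iff CT_group_iff by auto
qed

text \<open>Connecting two elements of \<open>S\<close> through one nontrivial element of \<open>M\<close>.\<close>

lemma (in group) comm_group_if_centralised:
  assumes "CT_group G" "subgroup S G" "subgroup M G" "M \<noteq> {\<one>}"
    and comm: "\<And>s m. s \<in> S \<Longrightarrow> m \<in> M \<Longrightarrow> s \<otimes> m = m \<otimes> s"
  shows "comm_group (G\<lparr>carrier := S\<rparr>)"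
proof (rule group.group_comm_groupI)
  show "group (G\<lparr>carrier := S\<rparr>)" using assms(2) by (rule subgroup_imp_group)
  obtain m where m: "m \<in> M" "m \<noteq> \<one>"
    using assms(4) subgroup.one_closed[OF assms(3)] by blast
  fix x y assume "x \<in> carrier (G\<lparr>carrier := S\<rparr>)" "y \<in> carrier (G\<lparr>carrier := S\<rparr>)"
  then have xy: "x \<in> S" "y \<in> S" by auto
  then have "x \<in> carrier G" "y \<in> carrier G" "m \<in> carrier G - {\<one>}"
      "x \<otimes> m = m \<otimes> x" "m \<otimes> y = y \<otimes> m"
    using m comm[of x m] comm[of y m]
      subgroup.mem_carrier[OF assms(2)] subgroup.mem_carrier[OF assms(3)] by auto
  then have "x \<otimes> y = y \<otimes> x"
    using assms(1) unfolding CT_group_iff by blast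
  then show "x \<otimes>\<^bsub>G\<lparr>carrier := S\<rparr>\<^esub> y = y \<otimes>\<^bsub>G\<lparr>carrier := S\<rparr>\<^esub> x" by simp
qed

section \<open>Normal subgroups of a subgroup\<close>

text \<open>The commutator of \<open>m\<close> and \<open>n\<close> lies in both subgroups.\<close>

lemma (in group) disjoint_normal_commute:
  assumes "M \<lhd> G" "N \<lhd> G" "M \<inter> N = {\<one>}" "m \<in> M" "n \<in> N"
  shows "m \<otimes> n = n \<otimes> m"
proof -
  interpret M: normal M G by fact
  interpret N: normal N G by fact
  have c: "m \<in> carrier G" "n \<in> carrier G" using assms by auto
  have "m \<otimes> n \<otimes> inv m \<otimes> inv n \<in> N"
    using assms c N.inv_op_closed2 by simp
  moreover have "m \<otimes> (n \<otimes> inv m \<otimes> inv n) \<in> M"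
    using assms c M.inv_op_closed2 by simp
  ultimately have "m \<otimes> n \<otimes> inv m \<otimes> inv n = \<one>"
    using assms(3) c by (auto simp: m_assoc)
  then have "m \<otimes> n \<otimes> inv m = n"
    using c inv_solve_right'[of \<one> "m \<otimes> n \<otimes> inv m" n] by simp
  then show ?thesis
    using c inv_solve_right'[of n "m \<otimes> n" m] by simp
qed

lemma (in group) normal_in_subgroup_iff:
  assumes "subgroup K G"
  shows "A \<lhd> G\<lparr>carrier := K\<rparr> \<longleftrightarrow>
    subgroup A G \<and> A \<subseteq> K \<and> (\<forall>x\<in>K. \<forall>a\<in>A. x \<otimes> a \<otimes> inv x \<in> A)"
proof -
  interpret K: group "G\<lparr>carrier := K\<rparr>" using assms by (rule subgroup_imp_group)
  have iff: "subgroup A (G\<lparr>carrier := K\<rparr>) \<longleftrightarrow> subgroup A G \<and> A \<subseteq> K"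
  proof
    assume A: "subgroup A (G\<lparr>carrier := K\<rparr>)"
    show "subgroup A G \<and> A \<subseteq> K"
      using incl_subgroup[OF assms A] subgroup.subset[OF A] by simp
  next
    assume "subgroup A G \<and> A \<subseteq> K"
    then show "subgroup A (G\<lparr>carrier := K\<rparr>)" using subgroup_incl[OF _ assms] by simp
  qed
  show ?thesis
    unfolding K.normal_inv_iff iff by (simp add: m_inv_consistent[OF assms])
qed

text \<open>Conjugation by \<open>g\<close> is an automorphism of the normal subgroup \<open>K\<close>.\<close>

lemma (in group) conjugate_normal_in_normal:
  assumes K: "K \<lhd> G" and A: "A \<lhd> G\<lparr>carrier := K\<rparr>" and g: "g \<in> carrier G"
  shows "(\<lambda>x. g \<otimes> x \<otimes> inv g) ` A \<lhd> G\<lparr>carrier := K\<rparr>"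
proof -
  interpret K: normal K G by fact
  have grp: "group (G\<lparr>carrier := K\<rparr>)"
    using K.subgroup_axioms by (rule subgroup_imp_group)
  have "(\<lambda>x. g \<otimes> x \<otimes> inv g) \<in> iso (G\<lparr>carrier := K\<rparr>) (G\<lparr>carrier := K\<rparr>)"
  proof (rule isoI)
    show "(\<lambda>x. g \<otimes> x \<otimes> inv g) \<in> hom (G\<lparr>carrier := K\<rparr>) (G\<lparr>carrier := K\<rparr>)"
    proof (rule homI; simp)
      fix x y assume "x \<in> K" "y \<in> K"
      then show "g \<otimes> (x \<otimes> y) \<otimes> inv g = g \<otimes> x \<otimes> inv g \<otimes> (g \<otimes> y \<otimes> inv g)"
        using g by (simp add: conjugate_mult)
    qed (use g K.inv_op_closed2 in auto)
    show "bij_betw (\<lambda>x. g \<otimes> x \<otimes> inv g)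
        (carrier (G\<lparr>carrier := K\<rparr>)) (carrier (G\<lparr>carrier := K\<rparr>))"
      by (rule bij_betw_byWitness[where f' = "\<lambda>x. inv g \<otimes> x \<otimes> g"])
        (use g K.inv_op_closed1 K.inv_op_closed2 in \<open>auto simp: m_assoc inv_mult_cancel_left\<close>)
  qed
  then show ?thesis using grp A by (intro iso_normal_subgroup) auto
qed

section \<open>Climbing a subnormal series\<close>

text \<open>
  Any two \<open>G\<close>-conjugates of \<open>A\<close> centralise each other: if they intersect trivially because both
  are normal in \<open>K\<close>, and otherwise by commutative transitivity through a common element.  Hence
  the centraliser of \<open>A\<close> in \<open>K\<close> is also the centraliser of each conjugate of \<open>A\<close>, so it is normal
  in \<open>G\<close>; by commutative transitivity it is abelian.
\<close>

lemma (in group) abelian_normal_ascends: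
  assumes CT: "CT_group G" and K: "K \<lhd> G" and A: "A \<lhd> G\<lparr>carrier := K\<rparr>"
    and abelian: "comm_group (G\<lparr>carrier := A\<rparr>)" and nontrivial: "A \<noteq> {\<one>}"
  obtains B where "B \<lhd> G" "comm_group (G\<lparr>carrier := B\<rparr>)" "B \<noteq> {\<one>}"
proof -
  interpret K: normal K G by fact
  interpret KG: group "G\<lparr>carrier := K\<rparr>"
    using K.subgroup_axioms by (rule subgroup_imp_group)
  have subA: "subgroup A G" and AK: "A \<subseteq> K"
    using A normal_in_subgroup_iff[OF K.subgroup_axioms] by auto
  have Ac: "a \<in> carrier G" if "a \<in> A" for a
    using that subgroup.mem_carrier[OF subA] by simp
  obtain a0 where a0: "a0 \<in> A" "a0 \<noteq> \<one>"
    using nontrivial subgroup.one_closed[OF subA] by blast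
  have trans: "x \<otimes> z = z \<otimes> x"
    if "x \<otimes> y = y \<otimes> x" "y \<otimes> z = z \<otimes> y" "y \<noteq> \<one>"
      "x \<in> carrier G" "y \<in> carrier G" "z \<in> carrier G" for x y z
    using CT that unfolding CT_group_iff by blast
  have commA: "a \<otimes> b = b \<otimes> a" if "a \<in> A" "b \<in> A" for a b
    using comm_groupE(4)[OF abelian] that by simp
  have conj_comm: "g \<otimes> x \<otimes> inv g \<otimes> (g \<otimes> y \<otimes> inv g) = g \<otimes> y \<otimes> inv g \<otimes> (g \<otimes> x \<otimes> inv g)"
    if "x \<otimes> y = y \<otimes> x" "g \<in> carrier G" "x \<in> carrier G" "y \<in> carrier G" for g x y
    using that by (simp only: conjugate_mult)
  have conj_commA: "g \<otimes> b \<otimes> inv g \<otimes> a = a \<otimes> (g \<otimes> b \<otimes> inv g)"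
    if "a \<in> A" "b \<in> A" "g \<in> carrier G" for a b g
  proof -
    let ?Ag = "(\<lambda>x. g \<otimes> x \<otimes> inv g) ` A"
    have Ag: "?Ag \<lhd> G\<lparr>carrier := K\<rparr>"
      using K A that(3) by (rule conjugate_normal_in_normal)
    show ?thesis
    proof (cases "?Ag \<inter> A = {\<one>}")
      case True
      then show ?thesis
        using KG.disjoint_normal_commute[OF Ag A, of "g \<otimes> b \<otimes> inv g" a] that by simp
    next
      case False
      moreover have "\<one> \<in> ?Ag \<inter> A"
        using subgroup.one_closed[OF normal_imp_subgroup[OF Ag]] subgroup.one_closed[OF subA]
        by auto
      ultimately obtain c d where c: "c \<in> A" "c \<noteq> \<one>" "c = g \<otimes> d \<otimes> inv g" "d \<in> A"
        by blast
      have "g \<otimes> b \<otimes> inv g \<otimes> c = c \<otimes> (g \<otimes> b \<otimes> inv g)"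
        unfolding c(3)
        using commA[OF that(2) c(4)] that(3) Ac[OF that(2)] Ac[OF c(4)] by (rule conj_comm)
      from this commA[OF c(1) that(1)] c(2) show ?thesis
        by (rule trans) (use that Ac c(1) in auto)
    qed
  qed
  define B where "B = {x \<in> K. \<forall>a\<in>A. x \<otimes> a = a \<otimes> x}"
  have Bc: "x \<in> carrier G" if "x \<in> B" for x using that by (simp add: B_def)
  have "subgroup B G"
  proof (rule subgroupI)
    show "B \<subseteq> carrier G" using Bc by auto
    show "B \<noteq> {}" using commA AK a0 by (auto simp: B_def)
  next
    fix x assume x: "x \<in> B"
    have "inv x \<otimes> a = a \<otimes> inv x" if "a \<in> A" for a
    proof -
      have "x \<otimes> a = a \<otimes> x" using x that by (simp add: B_def)
      then have "a = x \<otimes> a \<otimes> inv x"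
        using Bc[OF x] Ac[OF that] inv_solve_right[of a "x \<otimes> a" x] by simp
      then show ?thesis
        using Bc[OF x] Ac[OF that] inv_solve_left'[of "a \<otimes> inv x" x a] by (simp add: m_assoc)
    qed
    then show "inv x \<in> B" using x by (simp add: B_def)
  next
    fix x y assume xy: "x \<in> B" "y \<in> B"
    have "x \<otimes> y \<otimes> a = a \<otimes> (x \<otimes> y)" if "a \<in> A" for a
    proof -
      note c = Bc[OF xy(1)] Bc[OF xy(2)] Ac[OF that]
      have "x \<otimes> y \<otimes> a = x \<otimes> (a \<otimes> y)" using c xy that by (simp add: B_def m_assoc)
      also have "\<dots> = x \<otimes> a \<otimes> y" using c by (simp add: m_assoc)
      also have "\<dots> = a \<otimes> (x \<otimes> y)" using c xy that by (simp add: B_def m_assoc)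
      finally show ?thesis .
    qed
    then show "x \<otimes> y \<in> B" using xy by (simp add: B_def)
  qed
  moreover have "g \<otimes> x \<otimes> inv g \<in> B" if "g \<in> carrier G" "x \<in> B" for g x
  proof -
    have "g \<otimes> x \<otimes> inv g \<otimes> a = a \<otimes> (g \<otimes> x \<otimes> inv g)" if a: "a \<in> A" for a
      \<comment> \<open>The conjugate of \<open>a0\<close> commutes with both sides: with \<open>g \<otimes> x \<otimes> inv g\<close> as \<open>x\<close> centralises
        \<open>A\<close>, and with \<open>a\<close> as conjugates of \<open>A\<close> centralise \<open>A\<close>.\<close>
    proof (rule trans)
      show "g \<otimes> x \<otimes> inv g \<otimes> (g \<otimes> a0 \<otimes> inv g) = g \<otimes> a0 \<otimes> inv g \<otimes> (g \<otimes> x \<otimes> inv g)"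
        using \<open>g \<in> carrier G\<close> \<open>x \<in> B\<close> a0 Bc Ac by (intro conj_comm) (auto simp: B_def)
      show "g \<otimes> a0 \<otimes> inv g \<otimes> a = a \<otimes> (g \<otimes> a0 \<otimes> inv g)"
        using a a0 \<open>g \<in> carrier G\<close> by (intro conj_commA)
      show "g \<otimes> a0 \<otimes> inv g \<noteq> \<one>"
        using a0 Ac \<open>g \<in> carrier G\<close> by (simp add: conjugate_eq_one_iff)
    qed (use \<open>g \<in> carrier G\<close> \<open>x \<in> B\<close> a a0 Bc Ac in auto)
    then show ?thesis
      using that K.inv_op_closed2 by (simp add: B_def)
  qed
  ultimately have "B \<lhd> G" by (simp add: normal_inv_iff)
  moreover have "comm_group (G\<lparr>carrier := B\<rparr>)"
    using CT \<open>subgroup B G\<close> subA nontrivial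
    by (rule comm_group_if_centralised) (simp add: B_def)
  moreover have "B \<noteq> {\<one>}"
    using a0 commA AK by (auto simp: B_def)
  ultimately show thesis by (rule that)
qed

text \<open>
  A lower bound of all nontrivial normal subgroups, rather than a minimal one among them, lies
  below its own conjugates, which is what carries its normality up a subnormal series; and it is
  evidently the only minimal one.
\<close>

definition least_nontrivial_normal :: "'a set \<Rightarrow> ('a, 'b) monoid_scheme \<Rightarrow> bool" where
  "least_nontrivial_normal S G \<longleftrightarrow> S \<lhd> G \<and> S \<noteq> {\<one>\<^bsub>G\<^esub>} \<and>
     (\<forall>M. M \<lhd> G \<and> M \<noteq> {\<one>\<^bsub>G\<^esub>} \<longrightarrow> S \<subseteq> M)"

text \<open>
  Every conjugate of \<open>S\<close> contains \<open>S\<close>, which makes \<open>S\<close> normal in \<open>G\<close>.  A normal subgroup meeting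
  \<open>S\<close> trivially would centralise it, contradicting that \<open>S\<close> is nonabelian.
\<close>

lemma (in group) least_nontrivial_normal_ascends:
  assumes CT: "CT_group G" and K: "K \<lhd> G"
    and S: "least_nontrivial_normal S (G\<lparr>carrier := K\<rparr>)"
    and nonabelian: "\<not> comm_group (G\<lparr>carrier := S\<rparr>)"
  shows "least_nontrivial_normal S G"
proof -
  interpret K: normal K G by fact
  note K_iff = normal_in_subgroup_iff[OF K.subgroup_axioms]
  have SK: "S \<lhd> G\<lparr>carrier := K\<rparr>" and nontrivial: "S \<noteq> {\<one>}"
    and least: "\<And>M. M \<lhd> G\<lparr>carrier := K\<rparr> \<Longrightarrow> M \<noteq> {\<one>} \<Longrightarrow> S \<subseteq> M"
    using S by (auto simp: least_nontrivial_normal_def)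
  have subS: "subgroup S G" and "S \<subseteq> K" using SK K_iff by auto
  have Sc: "s \<in> carrier G" if "s \<in> S" for s
    using that subgroup.mem_carrier[OF subS] by simp
  obtain s0 where s0: "s0 \<in> S" "s0 \<noteq> \<one>"
    using nontrivial subgroup.one_closed[OF subS] by blast
  have normal: "S \<lhd> G"
    unfolding normal_inv_iff
  proof (intro conjI ballI)
    fix g s assume g: "g \<in> carrier G" and s: "s \<in> S"
    \<comment> \<open>The conjugate by \<open>inv g\<close> contains \<open>S\<close>, so conjugation by \<open>g\<close> maps \<open>S\<close> into \<open>S\<close>.\<close>
    let ?T = "(\<lambda>x. inv g \<otimes> x \<otimes> inv (inv g)) ` S"
    have "inv g \<otimes> s0 \<otimes> inv (inv g) \<noteq> \<one>"
      using s0 Sc g by (simp only: conjugate_eq_one_iff inv_closed not_False_eq_True)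
    then have "?T \<noteq> {\<one>}" using s0 by blast
    then have "S \<subseteq> ?T"
      using K SK g by (intro least conjugate_normal_in_normal) auto
    then obtain t where t: "t \<in> S" "s = inv g \<otimes> t \<otimes> g" using s g by auto
    then have "g \<otimes> s \<otimes> inv g = t"
      using g Sc by (simp add: m_assoc inv_mult_cancel_left)
    then show "g \<otimes> s \<otimes> inv g \<in> S" using t by simp
  qed (rule subS)
  have "S \<subseteq> M" if M: "M \<lhd> G" "M \<noteq> {\<one>}" for M
  proof -
    interpret M: normal M G by fact
    have "M \<inter> S \<noteq> {\<one>}"
    proof
      assume "M \<inter> S = {\<one>}"
      then have "comm_group (G\<lparr>carrier := S\<rparr>)"
        using disjoint_normal_commute[OF M(1) normal]
        by (intro comm_group_if_centralised[OF CT subS M.subgroup_axioms M(2)]) simp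
      then show False using nonabelian by simp
    qed
    moreover have "M \<inter> S \<lhd> G\<lparr>carrier := K\<rparr>"
      unfolding K_iff
      using \<open>S \<subseteq> K\<close> subS M.subgroup_axioms subgroups_Inter_pair M.inv_op_closed2
        normal.inv_op_closed2[OF normal] by auto
    ultimately show ?thesis using least by blast
  qed
  then show ?thesis using normal nontrivial by (simp add: least_nontrivial_normal_def)
qed

lemma monolith_eq_least_nontrivial_normal:
  assumes "group G" "least_nontrivial_normal S G"
  shows "monolithic G" "monolith G = S"
proof -
  have "minimal_normal_subgroup N G \<longleftrightarrow> N = S" for N
    using assms(2) unfolding minimal_normal_subgroup_def least_nontrivial_normal_def by blast
  then show "monolithic G" "monolith G = S"
    using assms(1) by (simp_all add: monolithic_def monolith_def)
qed

section \<open>The bottom of a composition series\<close>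

lemma simple_grp_iso:
  assumes "simple_grp G" "group F" "\<phi> \<in> iso G F"
  shows "simple_grp F"
proof -
  have G: "group G" using assms(1) by (simp add: simple_grp_def)
  have bij: "bij_betw \<phi> (carrier G) (carrier F)" and hom: "\<phi> \<in> hom G F"
    using assms(3) by (auto simp: iso_def)
  have one: "\<phi> \<one>\<^bsub>G\<^esub> = \<one>\<^bsub>F\<^esub>" using hom G assms(2) by (rule hom_one)
  let ?\<psi> = "inv_into (carrier G) \<phi>"
  have "carrier F \<noteq> {\<one>\<^bsub>F\<^esub>}"
  proof
    assume "carrier F = {\<one>\<^bsub>F\<^esub>}"
    then have "\<phi> ` carrier G = \<phi> ` {\<one>\<^bsub>G\<^esub>}" using bij one by (auto simp: bij_betw_def)
    then have "carrier G = {\<one>\<^bsub>G\<^esub>}"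
      using bij group.subgroup_self[OF G] subgroup.one_closed
      by (intro inj_on_image_eq_iff[THEN iffD1, of \<phi> "carrier G"]) (auto simp: bij_betw_def)
    then show False using assms(1) by (simp add: simple_grp_def)
  qed
  moreover have "H = carrier F \<or> H = {\<one>\<^bsub>F\<^esub>}" if H: "H \<lhd> F" for H
  proof -
    have "?\<psi> ` H \<lhd> G"
      using group.iso_set_sym[OF G assms(3)] assms(2) G H by (rule iso_normal_subgroup)
    then have "?\<psi> ` H = carrier G \<or> ?\<psi> ` H = {\<one>\<^bsub>G\<^esub>}"
      using assms(1) by (simp add: simple_grp_def)
    moreover have "\<phi> ` ?\<psi> ` H = H"
      using bij subgroup.subset[OF normal_imp_subgroup[OF H]]
      by (intro image_inv_into_cancel) (auto simp: bij_betw_def)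
    ultimately show ?thesis using bij one by (auto simp: bij_betw_def)
  qed
  ultimately show ?thesis using assms(2) by (simp add: simple_grp_def)
qed

lemma composition_series_bottom_simple:
  fixes G (structure)
  assumes "group G" "composition_series G n H" "0 < n"
  shows "simple_grp (G\<lparr>carrier := H 1\<rparr>)"
proof -
  interpret group G by fact
  have sub: "subgroup (H 1) G" and "H 0 = {\<one>}"
    and simple: "simple_grp (G\<lparr>carrier := H 1\<rparr> Mod H 0)"
    using assms(2,3) by (auto simp: composition_series_def)
  interpret S: group "G\<lparr>carrier := H 1\<rparr>" using sub by (rule subgroup_imp_group)
  show ?thesis
    using simple S.is_group S.trivial_factor_iso \<open>H 0 = {\<one>}\<close>
    by (auto intro: simple_grp_iso)
qed

section \<open>The monolith\<close>

theorem theorem4p2: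
  fixes G (structure)
  assumes "CT_group G"
    and "carrier G \<noteq> {\<one>}"
    and "\<And>A. A \<lhd> G \<Longrightarrow> comm_group (G\<lparr>carrier := A\<rparr>) \<Longrightarrow> A = {\<one>}"
    and "\<exists>n H. composition_series G n H"
  shows "monolithic G \<and>
    simple_grp (G\<lparr>carrier := monolith G\<rparr>) \<and>
    \<not> comm_group (G\<lparr>carrier := monolith G\<rparr>) \<and>
    CT_group (G\<lparr>carrier := monolith G\<rparr>)"
proof -
  interpret group G using assms(1) by (simp add: CT_group_def)
  obtain n H where series: "composition_series G n H" using assms(4) by blast
  have top: "H n = carrier G" and sub: "\<And>i. i \<le> n \<Longrightarrow> subgroup (H i) G"
    and step: "\<And>i. i < n \<Longrightarrow> H i \<lhd> G\<lparr>carrier := H (Suc i)\<rparr>"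
    using series by (auto simp: composition_series_def)
  have "n \<noteq> 0"
    using series assms(2) by (auto simp: composition_series_def intro: ccontr)
  then have n: "1 \<le> n" by simp
  have grp: "group (G\<lparr>carrier := H i\<rparr>)" if "i \<le> n" for i
    using sub[OF that] by (rule subgroup_imp_group)
  have CT: "CT_group (G\<lparr>carrier := H i\<rparr>)" if "i \<le> n" for i
    using assms(1) sub[OF that] by (rule CT_group_subgroup)
  have simple: "simple_grp (G\<lparr>carrier := H 1\<rparr>)"
    using composition_series_bottom_simple[OF is_group series] n by simp
  then have nontrivial: "H 1 \<noteq> {\<one>}" by (simp add: simple_grp_def)
  have self: "H 1 \<lhd> G\<lparr>carrier := H 1\<rparr>"
    using normal_in_subgroup_iff[OF sub[OF n]] sub[OF n]
    by (auto intro!: subgroup.m_closed subgroup.m_inv_closed)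
  have nonabelian: "\<not> comm_group (G\<lparr>carrier := H 1\<rparr>)"
  proof
    assume abelian: "comm_group (G\<lparr>carrier := H 1\<rparr>)"
    have "\<exists>A. A \<lhd> G\<lparr>carrier := H i\<rparr> \<and> comm_group (G\<lparr>carrier := A\<rparr>) \<and> A \<noteq> {\<one>}"
      if "1 \<le> i" "i \<le> n" for i
      using that
    proof (induction i rule: nat_induct_at_least)
      case base
      then show ?case using self abelian nontrivial by blast
    next
      case (Suc i)
      then obtain A where A: "A \<lhd> G\<lparr>carrier := H i\<rparr>"
          "comm_group (G\<lparr>carrier := A\<rparr>)" "A \<noteq> {\<one>}" by auto
      interpret L: group "G\<lparr>carrier := H (Suc i)\<rparr>" using grp Suc.prems by simp
      have "H i \<lhd> G\<lparr>carrier := H (Suc i)\<rparr>" using step Suc.prems by simp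
      from L.abelian_normal_ascends[OF CT[OF Suc.prems] this, of A] A
      obtain B where "B \<lhd> G\<lparr>carrier := H (Suc i)\<rparr>"
          "comm_group (G\<lparr>carrier := B\<rparr>)" "B \<noteq> {\<one>}" by auto
      then show ?case by blast
    qed
    from this[OF n order_refl] obtain A where "A \<lhd> G"
        "comm_group (G\<lparr>carrier := A\<rparr>)" "A \<noteq> {\<one>}" by (auto simp: top)
    then show False using assms(3) by blast
  qed
  have "least_nontrivial_normal (H 1) (G\<lparr>carrier := H i\<rparr>)" if "1 \<le> i" "i \<le> n" for i
    using that
  proof (induction i rule: nat_induct_at_least)
    case base
    then show ?case
      using simple self nontrivial by (auto simp: least_nontrivial_normal_def simple_grp_def)
  next
    case (Suc i)
    interpret L: group "G\<lparr>carrier := H (Suc i)\<rparr>" using grp Suc.prems by simp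
    have "H i \<lhd> G\<lparr>carrier := H (Suc i)\<rparr>" using step Suc.prems by simp
    then show ?case
      using L.least_nontrivial_normal_ascends[OF CT[OF Suc.prems], of "H i" "H 1"]
        Suc nonabelian by simp
  qed
  from this[OF n order_refl] have "least_nontrivial_normal (H 1) G" by (simp add: top)
  then have "monolithic G" "monolith G = H 1"
    using monolith_eq_least_nontrivial_normal[OF is_group] by auto
  then show ?thesis using simple nonabelian CT[OF n] by simp
qed

end
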